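(* Let $(X,d)$ be a metric space and let $\alpha,\beta\in{}^*\mathbb R$ be scales with $0<\beta<\alpha$. Let $(X_\alpha,\delta_\alpha,\Delta_\alpha)$ and $(X_\beta,\delta_\beta,\Delta_\beta)$ be the (nonstandard) $\alpha$-scaling and $\beta$-scaling of $(X,d)$, and let $\pi_{\beta,\alpha}:X_\alpha\to X_\beta$ be the natural surjective map characterized by $\pi_\beta=\pi_{\beta,\alpha}\circ\pi_\alpha$. Then $\pi_{\beta,\alpha}$ is a $(\beta/\alpha)$-contraction from the galactic space $(X_\alpha,\delta_\alpha,\Delta_\alpha)$ onto the galactic space $(X_\beta,\delta_\beta,\Delta_\beta)$.
   Context: Fix a nonstandard model (a nonstandard extension of a superstructure over a set containing $X\cup\mathbb R$, with a sufficient saturation property, no particular refinement being required; e.g. ultrapowers over a non-principal ultrafilter on $\mathbb N$). It provides ${}^*\mathbb R$ (a proper ordered field extension of $\mathbb R$), ${}^*X$ and ${}^*d:{}^*X\times{}^*X\to{}^*\mathbb R_+$. Write $\mathbb K={}^*\mathbb R$. An element $s\in\mathbb K$ is infinitely small ($s\simeq 0$) if $|s|<1/n$ for all integers $n\ge 1$, infinitely large if $|s|>n$ for all (standard) $n\in\mathbb N$ (written $s\simeq+\infty$ if $s>0$, $s\simeq-\infty$ if $s<0$), and limited if it is not infinitely large. $\mathrm{Gal}(0)$ is the additive subgroup of limited elements; $\mathrm{Gal}(\mathbb K)=\mathbb K/\mathrm{Gal}(0)$ with canonical projection $\mathrm{Gal}$, totally ordered by $\mathrm{Gal}(s)\le\mathrm{Gal}(t)$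 iff $s\le t$ or $s-t\in\mathrm{Gal}(0)$. The standard part map $\mathrm{st}:\mathbb K\to\mathbb R\cup\{\pm\infty\}$ sends limited $s$ to the unique real infinitely close to $s$ and $s\simeq\pm\infty$ to $\pm\infty$. For an ordered additive group $G$, $G_+=\{x\in G:x\ge 0\}$; $x<+\infty$ and $x+(+\infty)=(+\infty)+x=+\infty$. A map $d$ on $Y\times Y$ with values in $G_+$ or $G_+\cup\{+\infty\}$ satisfies the general metric rule if for all $x,y,z$: $d(x,x)=0$; $d(x,y)=d(y,x)>0$ if $x\ne y$; $d(x,z)\le d(x,y)+d(y,z)$. A generalized distance on a set $F$ is a map $\delta:F\times F\to\mathbb R_+\cup\{+\infty\}$ satisfying this rule. The metric components of $F$ are the equivalence classes of the relation $\delta(x,y)<+\infty$; $\mathcal M_F$ is their set and $C_F(x)$ is the one containing $x$. A galactic distance on a set $\mathcal E$ is a map $\Delta:\mathcal E\times\mathcal E\to\mathrm{Gal}(\mathbb K)_+$ satisfying the rule. A galactic space is a triple $(F,\delta,\Delta)$ with $\delta$ a generalized distance on the set $F$ and $\Delta$ a galactic distance on $\mathcal M_F$. For limited $\gamma>0$ in $\mathbb K$ and $\tau=\mathrm{Gal}(t)$, put $\gamma.\tau=\{\gamma s:s\in\tau\}$ and $\gamma\bullet\tau=\mathrm{Gal}(\gamma t)$. If $\tau>0$, $\mathrm{st}$ is constant on $\gamma.\tau$ with value denoted $\mathrm{st}(\gamma.\tau)$. A morphism $(F,\delta,\Delta)\to(F',\delta',\Delta')$ is a map $f:F\to F'$ for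 which there is a limited $\gamma>0$ with (1) $\delta'(f(x_1),f(x_2))\le\gamma\,\delta(x_1,x_2)$ for all $x_1,x_2$ (with $\gamma\cdot(+\infty)=+\infty$), so that each $f(E)$, $E\in\mathcal M_F$, lies in a unique metric component $f[E]$ of $F'$; and (2) $\Delta'(f[E_1],f[E_2])\le\gamma\bullet\Delta(E_1,E_2)$ for all $E_1,E_2\in\mathcal M_F$. A $\gamma$-contraction is a morphism $f$ that is surjective and such that for all $x_1,x_2\in F$, $E_1,E_2\in\mathcal M_F$: $\delta'(f(x_1),f(x_2))=\mathrm{st}(\gamma\,\delta(x_1,x_2))$ if $\delta(x_1,x_2)<+\infty$; $\delta'(f(x_1),f(x_2))=\mathrm{st}(\gamma.\Delta(C_F(x_1),C_F(x_2)))$ if $\delta(x_1,x_2)=+\infty$; and $\Delta'(f[E_1],f[E_2])=\gamma\bullet\Delta(E_1,E_2)$. A scale is an element $\alpha\in{}^*\mathbb R$ with $\alpha>0$. For a scale $\alpha$, $x\simeq_\alpha y$ on ${}^*X$ means $\alpha\,{}^*d(x,y)\simeq 0$; $X_\alpha={}^*X/\!\simeq_\alpha$ with canonical projection $\pi_\alpha:{}^*X\to X_\alpha$. The $\alpha$-scaling of $(X,d)$ is the galactic space $(X_\alpha,\delta_\alpha,\Delta_\alpha)$ where $\delta_\alpha(\pi_\alpha(x),\pi_\alpha(y))=\mathrm{st}(\alpha\,{}^*d(x,y))$ and, for metric components $E_1,E_2$ of $X_\alpha$ and any $x_1,x_2\in{}^*X$ with $\pi_\alpha(x_i)\in E_i$,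 $\Delta_\alpha(E_1,E_2)=\mathrm{Gal}(\alpha\,{}^*d(x_1,x_2))$. For scales $\beta\le\alpha$, $x\simeq_\alpha y$ implies $x\simeq_\beta y$, which gives the map $\pi_{\beta,\alpha}$. *)

theory Defs
  imports "HOL-Analysis.Analysis"
begin

section \<open>Nonstandard extensions\<close>

text \<open>
  The base set of atoms is \<open>'a + real\<close>, the nonstandard atoms are \<open>'y + 'k\<close>, where \<open>'k\<close>
  plays the role of the nonstandard reals.  A superstructure over an infinite set
  is not available as a HOL type; what is kept of the extension is its action
  \<open>star\<close> on the finitary relations over the atoms (a relation of arity \<open>n\<close> is a set of
  lists of length \<open>n\<close>), together with the transfer principle for all first-order
  formulas over the atoms in which an arbitrary relation may occur as a symbol.
  Every nonstandard extension of a superstructure restricts to such data.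
\<close>

datatype 's fm =
    Rel "'s list set" "nat list"
  | Eq nat nat
  | Neg "'s fm"
  | Conj "'s fm" "'s fm"
  | Ex nat "'s fm"

primrec sat :: "('s list set \<Rightarrow> 't list set) \<Rightarrow> (nat \<Rightarrow> 't) \<Rightarrow> 's fm \<Rightarrow> bool" where
  "sat I e (Rel A vs) \<longleftrightarrow> map e vs \<in> I A"
| "sat I e (Eq m n) \<longleftrightarrow> e m = e n"
| "sat I e (Neg \<phi>) \<longleftrightarrow> \<not> sat I e \<phi>"
| "sat I e (Conj \<phi> \<psi>) \<longleftrightarrow> sat I e \<phi> \<and> sat I e \<psi>"
| "sat I e (Ex n \<phi>) \<longleftrightarrow> (\<exists>t. sat I (e(n := t)) \<phi>)"

text \<open>
  \<open>\<iota>\<close> and \<open>\<rho>\<close> are the embeddings of the standard atoms; free variables in \<open>transfer\<close>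
  stand for standard parameters.  The field structure and the order of the class
  \<open>linordered_field\<close> on \<open>'k\<close> are required to be the extensions of those of the reals.
  No saturation beyond properness is demanded, so every degree of saturation is covered.
\<close>

locale nonstandard_extension =
  fixes \<iota> :: "'a \<Rightarrow> 'y"
    and \<rho> :: "real \<Rightarrow> 'k::linordered_field"
    and star :: "('a + real) list set \<Rightarrow> ('y + 'k) list set"
  assumes transfer: "sat star (map_sum \<iota> \<rho> \<circ> e) \<phi> \<longleftrightarrow> sat (\<lambda>A. A) e \<phi>"
    and star_atoms: "star (range (\<lambda>x. [Inl x])) = range (\<lambda>y. [Inl y])"
    and star_reals: "star (range (\<lambda>r. [Inr r])) = range (\<lambda>s. [Inr s])"
    and star_add: "star {v. \<exists>a b. v = [Inr a, Inr b, Inr (a + b)]} = {v. \<exists>s t. v = [Inr s, Inr t, Inr (s + t)]}"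
    and star_mult: "star {v. \<exists>a b. v = [Inr a, Inr b, Inr (a * b)]} = {v. \<exists>s t. v = [Inr s, Inr t, Inr (s * t)]}"
    and star_le: "star {[Inr a, Inr b] | a b. a \<le> b} = {[Inr s, Inr t] | s t. s \<le> t}"
    and proper: "range \<rho> \<noteq> UNIV"

definition star_set :: "(('a + real) list set \<Rightarrow> ('y + 'k) list set) \<Rightarrow> 'a set \<Rightarrow> 'y set" where
  "star_set star X = {y. [Inl y] \<in> star {[Inl x] | x. x \<in> X}}"

definition star_dist ::
  "(('a + real) list set \<Rightarrow> ('y + 'k) list set) \<Rightarrow> 'a set \<Rightarrow> ('a \<Rightarrow> 'a \<Rightarrow> real) \<Rightarrow> 'y \<Rightarrow> 'y \<Rightarrow> 'k" where
  "star_dist star X d y z =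
    (THE t. [Inl y, Inl z, Inr t] \<in> star {[Inl a, Inl b, Inr (d a b)] | a b. a \<in> X \<and> b \<in> X})"


section \<open>Orders of magnitude and galaxies\<close>

definition inf_small :: "'k::linordered_field \<Rightarrow> bool" where
  "inf_small s \<longleftrightarrow> (\<forall>n::nat. n \<ge> 1 \<longrightarrow> \<bar>s\<bar> < 1 / of_nat n)"

definition inf_large :: "'k::linordered_field \<Rightarrow> bool" where
  "inf_large s \<longleftrightarrow> (\<forall>n::nat. \<bar>s\<bar> > of_nat n)"

definition limited :: "'k::linordered_field \<Rightarrow> bool" where
  "limited s \<longleftrightarrow> \<not> inf_large s"

lemma limited_iff: "limited s \<longleftrightarrow> (\<exists>n::nat. \<bar>s\<bar> \<le> of_nat n)"
  by (auto simp: limited_def inf_large_def not_less)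

lemma limited_0: "limited 0"
  by (auto simp: limited_iff)

lemma limited_uminus: "limited (- s) \<longleftrightarrow> limited s"
  by (simp add: limited_iff)

lemma limited_add:
  assumes "limited s" "limited t"
  shows "limited (s + t)"
proof -
  obtain m n where "\<bar>s\<bar> \<le> of_nat m" "\<bar>t\<bar> \<le> of_nat n"
    using assms by (auto simp: limited_iff)
  then have "\<bar>s + t\<bar> \<le> of_nat (m + n)"
    using abs_triangle_ineq[of s t] by simp
  then show ?thesis
    unfolding limited_iff by blast
qed

lemma limited_minus: "limited s \<Longrightarrow> limited t \<Longrightarrow> limited (s - t)"
  using limited_add[of s "- t"] by (simp add: limited_uminus)

lemma limited_mult:
  assumes "limited s" "limited t"
  shows "limited (s * t)"
proof -
  obtain m n where "\<bar>s\<bar> \<le> of_nat m" "\<bar>t\<bar> \<le> of_nat n"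
    using assms by (auto simp: limited_iff)
  then have "\<bar>s * t\<bar> \<le> of_nat (m * n)"
    by (simp add: abs_mult mult_mono)
  then show ?thesis
    unfolding limited_iff by blast
qed

lemma limited_mono: "limited t \<Longrightarrow> \<bar>s\<bar> \<le> \<bar>t\<bar> \<Longrightarrow> limited s"
  unfolding limited_iff using order_trans by blast

text \<open>\<open>Gal\<close> is the projection onto the quotient of \<open>'k\<close> by its subgroup of limited elements.\<close>

quotient_type (overloaded) 'k galaxy = "'k::linordered_field" / "\<lambda>s t. limited (s - t)"
  morphisms rep_galaxy Gal
proof (rule equivpI)
  show "reflp (\<lambda>s t::'k. limited (s - t))"
    by (simp add: reflp_def limited_0)
  show "symp (\<lambda>s t::'k. limited (s - t))"
    unfolding limited_iff by (simp add: symp_def abs_minus_commute)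
  show "transp (\<lambda>s t::'k. limited (s - t))"
  proof (rule transpI)
    fix r s t :: 'k
    assume "limited (r - s)" "limited (s - t)"
    then show "limited (r - t)"
      using limited_add[of "r - s" "s - t"] by simp
  qed
qed

lemma Gal_eq_iff: "Gal s = Gal t \<longleftrightarrow> limited (s - t)"
  by (rule galaxy.abs_eq_iff)

instantiation galaxy :: (linordered_field) linordered_ab_group_add
begin

lift_definition zero_galaxy :: "'a galaxy" is 0 .

lift_definition plus_galaxy :: "'a galaxy \<Rightarrow> 'a galaxy \<Rightarrow> 'a galaxy" is "(+)"
proof -
  fix s s' t t' :: 'a
  assume "limited (s - s')" "limited (t - t')"
  from limited_add[OF this] show "limited (s + t - (s' + t'))"
    by (simp add: algebra_simps)
qed

lift_definition uminus_galaxy :: "'a galaxy \<Rightarrow> 'a galaxy" is uminus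
proof -
  fix s t :: 'a
  assume "limited (s - t)"
  then have "limited (- (s - t))"
    by (simp only: limited_uminus)
  then show "limited (- s - - t)"
    by simp
qed

lift_definition minus_galaxy :: "'a galaxy \<Rightarrow> 'a galaxy \<Rightarrow> 'a galaxy" is "(-)"
proof -
  fix s s' t t' :: 'a
  assume "limited (s - s')" "limited (t - t')"
  from limited_minus[OF this] show "limited (s - t - (s' - t'))"
    by (simp add: algebra_simps)
qed

lift_definition less_eq_galaxy :: "'a galaxy \<Rightarrow> 'a galaxy \<Rightarrow> bool"
  is "\<lambda>s t. s \<le> t \<or> limited (s - t)"
proof -
  have *: "s' \<le> t' \<or> limited (s' - t')"
    if "limited (s - s')" "limited (t - t')" "s \<le> t \<or> limited (s - t)" for s s' t t' :: 'a
  proof (cases "s' \<le> t'")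
    case False
    have l: "limited ((t - t') - (s - s'))"
      using that limited_minus by blast
    show ?thesis
    proof (cases "s \<le> t")
      case True
      then have "\<bar>s' - t'\<bar> \<le> \<bar>(t - t') - (s - s')\<bar>"
        using False by simp
      then show ?thesis
        using l limited_mono by blast
    next
      case False
      then have "limited (s - t)"
        using that by blast
      from limited_add[OF this l] show ?thesis
        by (simp add: algebra_simps)
    qed
  qed simp
  fix s s' t t' :: 'a
  assume a: "limited (s - s')" "limited (t - t')"
  then have b: "limited (s' - s)" "limited (t' - t)"
    unfolding limited_iff by (simp_all add: abs_minus_commute)
  show "(s \<le> t \<or> limited (s - t)) = (s' \<le> t' \<or> limited (s' - t'))"
    using *[OF a] *[OF b] by blast
qed

definition less_galaxy :: "'a galaxy \<Rightarrow> 'a galaxy \<Rightarrow> bool" where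
  "less_galaxy \<sigma> \<tau> \<longleftrightarrow> \<sigma> \<le> \<tau> \<and> \<not> \<tau> \<le> \<sigma>"

instance
proof
  fix a b c :: "'a galaxy"
  show "a + b + c = a + (b + c)"
    by transfer (simp add: algebra_simps limited_0)
  show "a + b = b + a"
    by transfer (simp add: algebra_simps limited_0)
  show "0 + a = a"
    by transfer (simp add: limited_0)
  show "- a + a = 0"
    by transfer (simp add: limited_0)
  show "a - b = a + - b"
    by transfer (simp add: limited_0)
  show "a < b \<longleftrightarrow> a \<le> b \<and> \<not> b \<le> a"
    by (rule less_galaxy_def)
  show "a \<le> a"
    by transfer simp
  show "a \<le> b \<or> b \<le> a"
    by transfer auto
  show "c + a \<le> c + b" if "a \<le> b"
    using that by transfer simp
  show "a = b" if "a \<le> b" "b \<le> a"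
    using that
  proof transfer
    fix s t :: 'a
    assume "s \<le> t \<or> limited (s - t)" "t \<le> s \<or> limited (t - s)"
    moreover have "limited (t - s) \<longleftrightarrow> limited (s - t)"
      using limited_uminus[of "s - t"] by simp
    moreover have "limited (s - t)" if "s = t"
      using that by (simp add: limited_0)
    ultimately show "limited (s - t)"
      using order.antisym by blast
  qed
  show "a \<le> c" if "a \<le> b" "b \<le> c"
    using that
  proof transfer
    fix r s t :: 'a
    assume h: "r \<le> s \<or> limited (r - s)" "s \<le> t \<or> limited (s - t)"
    show "r \<le> t \<or> limited (r - t)"
    proof (cases "r \<le> t")
      case False
      consider "r \<le> s" "limited (s - t)" | "limited (r - s)" "s \<le> t" | "limited (r - s)" "limited (s - t)"
        using h False by fastforce
      then show ?thesis
      proof cases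
        case 1
        then have "\<bar>r - t\<bar> \<le> \<bar>s - t\<bar>" using False by simp
        then show ?thesis using 1 limited_mono by blast
      next
        case 2
        then have "\<bar>r - t\<bar> \<le> \<bar>r - s\<bar>" using False by simp
        then show ?thesis using 2 limited_mono by blast
      next
        case 3
        then show ?thesis using limited_add[of "r - s" "s - t"] by simp
      qed
    qed simp
  qed
qed

end

definition st :: "(real \<Rightarrow> 'k) \<Rightarrow> 'k::linordered_field \<Rightarrow> ereal" where
  "st \<rho> s =
    (if limited s then ereal (THE r. inf_small (s - \<rho> r)) else if s > 0 then \<infinity> else - \<infinity>)"

definition gal_cdot :: "'k::linordered_field \<Rightarrow> 'k galaxy \<Rightarrow> 'k set" where
  "gal_cdot \<gamma> \<tau> = {\<gamma> * s | s. Gal s = \<tau>}"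

definition gal_bullet :: "'k::linordered_field \<Rightarrow> 'k galaxy \<Rightarrow> 'k galaxy" where
  "gal_bullet \<gamma> \<tau> = (THE \<sigma>. \<forall>t. Gal t = \<tau> \<longrightarrow> \<sigma> = Gal (\<gamma> * t))"

lemma gal_bullet_Gal:
  assumes "limited \<gamma>"
  shows "gal_bullet \<gamma> (Gal t) = Gal (\<gamma> * t)"
  unfolding gal_bullet_def
proof (rule the_equality)
  show "\<forall>s. Gal s = Gal t \<longrightarrow> Gal (\<gamma> * t) = Gal (\<gamma> * s)"
    using limited_mult[OF assms] by (simp add: Gal_eq_iff abs_minus_commute limited_iff flip: right_diff_distrib)
qed blast

definition st_set :: "(real \<Rightarrow> 'k) \<Rightarrow> 'k::linordered_field set \<Rightarrow> ereal" where
  "st_set \<rho> S = (THE v. \<forall>s\<in>S. st \<rho> s = v)"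


section \<open>Galactic spaces\<close>

text \<open>
  The rule forces the values of \<open>d\<close> on \<open>F\<close> to be nonnegative; so for \<open>'g = ereal\<close> it says
  that \<open>d\<close> is a generalized distance with values in the nonnegative reals and \<open>\<infinity>\<close>, and
  for \<open>'g = 'k galaxy\<close> that \<open>d\<close> is a galactic distance.
\<close>

definition metric_rule :: "'f set \<Rightarrow> ('f \<Rightarrow> 'f \<Rightarrow> 'g::{order, comm_monoid_add}) \<Rightarrow> bool" where
  "metric_rule F d \<longleftrightarrow>
    (\<forall>x\<in>F. d x x = 0) \<and>
    (\<forall>x\<in>F. \<forall>y\<in>F. x \<noteq> y \<longrightarrow> d x y = d y x \<and> d y x > 0) \<and>
    (\<forall>x\<in>F. \<forall>y\<in>F. \<forall>z\<in>F. d x z \<le> d x y + d y z)"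

definition comp_rel :: "'f set \<Rightarrow> ('f \<Rightarrow> 'f \<Rightarrow> ereal) \<Rightarrow> ('f \<times> 'f) set" where
  "comp_rel F \<delta> = {(x, y). x \<in> F \<and> y \<in> F \<and> \<delta> x y < \<infinity>}"

definition metric_comps :: "'f set \<Rightarrow> ('f \<Rightarrow> 'f \<Rightarrow> ereal) \<Rightarrow> 'f set set" where
  "metric_comps F \<delta> = F // comp_rel F \<delta>"

definition comp_of :: "'f set \<Rightarrow> ('f \<Rightarrow> 'f \<Rightarrow> ereal) \<Rightarrow> 'f \<Rightarrow> 'f set" where
  "comp_of F \<delta> x = comp_rel F \<delta> `` {x}"

record (overloaded) ('f, 'k::linordered_field) galactic =
  points :: "'f set"
  gdist :: "'f \<Rightarrow> 'f \<Rightarrow> ereal"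
  galdist :: "'f set \<Rightarrow> 'f set \<Rightarrow> 'k galaxy"

abbreviation comps :: "('f, 'k::linordered_field) galactic \<Rightarrow> 'f set set" where
  "comps G \<equiv> metric_comps (points G) (gdist G)"

definition galactic_space :: "('f, 'k::linordered_field) galactic \<Rightarrow> bool" where
  "galactic_space G \<longleftrightarrow> metric_rule (points G) (gdist G) \<and> metric_rule (comps G) (galdist G)"

definition image_comp ::
  "('f, 'k::linordered_field) galactic \<Rightarrow> ('f \<Rightarrow> 'g) \<Rightarrow> 'f set \<Rightarrow> ('g, 'k) galactic \<Rightarrow> 'g set" where
  "image_comp G f E G' = (THE E'. E' \<in> comps G' \<and> f ` E \<subseteq> E')"

text \<open>The first inequality is between elements of \<open>'k\<close> and \<open>\<infinity>\<close>, so it is trivial if \<open>\<delta> x y = \<infinity>\<close>.\<close>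

definition morphism ::
  "(real \<Rightarrow> 'k) \<Rightarrow> ('f, 'k::linordered_field) galactic \<Rightarrow> ('g, 'k) galactic \<Rightarrow> ('f \<Rightarrow> 'g) \<Rightarrow> bool" where
  "morphism \<rho> G G' f \<longleftrightarrow>
    galactic_space G \<and> galactic_space G' \<and> f \<in> points G \<rightarrow> points G' \<and>
    (\<exists>\<gamma>. limited \<gamma> \<and> \<gamma> > 0 \<and>
      (\<forall>x\<in>points G. \<forall>y\<in>points G. gdist G x y < \<infinity> \<longrightarrow>
        gdist G' (f x) (f y) < \<infinity> \<and>
        \<rho> (real_of_ereal (gdist G' (f x) (f y))) \<le> \<gamma> * \<rho> (real_of_ereal (gdist G x y))) \<and>
      (\<forall>E\<in>comps G. \<forall>E'\<in>comps G.
        galdist G' (image_comp G f E G') (image_comp G f E' G') \<le> gal_bullet \<gamma> (galdist G E E')))"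

definition contraction ::
  "(real \<Rightarrow> 'k) \<Rightarrow> 'k \<Rightarrow> ('f, 'k::linordered_field) galactic \<Rightarrow> ('g, 'k) galactic \<Rightarrow> ('f \<Rightarrow> 'g) \<Rightarrow> bool" where
  "contraction \<rho> \<gamma> G G' f \<longleftrightarrow>
    limited \<gamma> \<and> \<gamma> > 0 \<and> morphism \<rho> G G' f \<and> f ` points G = points G' \<and>
    (\<forall>x\<in>points G. \<forall>y\<in>points G.
      (gdist G x y < \<infinity> \<longrightarrow>
        gdist G' (f x) (f y) = st \<rho> (\<gamma> * \<rho> (real_of_ereal (gdist G x y)))) \<and>
      (gdist G x y = \<infinity> \<longrightarrow>
        gdist G' (f x) (f y) =
          st_set \<rho> (gal_cdot \<gamma> (galdist G (comp_of (points G) (gdist G) x) (comp_of (points G) (gdist G) y))))) \<and>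
    (\<forall>E\<in>comps G. \<forall>E'\<in>comps G.
      galdist G' (image_comp G f E G') (image_comp G f E' G') = gal_bullet \<gamma> (galdist G E E'))"


section \<open>Scalings\<close>

text \<open>In this section \<open>Y\<close> and \<open>D\<close> are the nonstandard extensions of a set and of its distance.\<close>

definition scale_rel :: "'y set \<Rightarrow> ('y \<Rightarrow> 'y \<Rightarrow> 'k::linordered_field) \<Rightarrow> 'k \<Rightarrow> ('y \<times> 'y) set" where
  "scale_rel Y D \<alpha> = {(x, y). x \<in> Y \<and> y \<in> Y \<and> inf_small (\<alpha> * D x y)}"

definition scale_proj :: "'y set \<Rightarrow> ('y \<Rightarrow> 'y \<Rightarrow> 'k::linordered_field) \<Rightarrow> 'k \<Rightarrow> 'y \<Rightarrow> 'y set" where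
  "scale_proj Y D \<alpha> x = scale_rel Y D \<alpha> `` {x}"

definition scaling ::
  "(real \<Rightarrow> 'k) \<Rightarrow> 'y set \<Rightarrow> ('y \<Rightarrow> 'y \<Rightarrow> 'k::linordered_field) \<Rightarrow> 'k \<Rightarrow> ('y set, 'k) galactic" where
  "scaling \<rho> Y D \<alpha> = \<lparr>
    points = Y // scale_rel Y D \<alpha>,
    gdist = (\<lambda>a b. THE v. \<forall>x\<in>Y. \<forall>y\<in>Y.
      scale_proj Y D \<alpha> x = a \<and> scale_proj Y D \<alpha> y = b \<longrightarrow> v = st \<rho> (\<alpha> * D x y)),
    galdist = (\<lambda>E E'. THE \<tau>. \<forall>x\<in>Y. \<forall>y\<in>Y.
      scale_proj Y D \<alpha> x \<in> E \<and> scale_proj Y D \<alpha> y \<in> E' \<longrightarrow> \<tau> = Gal (\<alpha> * D x y))\<rparr>"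

definition scale_map :: "'y set \<Rightarrow> ('y \<Rightarrow> 'y \<Rightarrow> 'k::linordered_field) \<Rightarrow> 'k \<Rightarrow> 'k \<Rightarrow> 'y set \<Rightarrow> 'y set" where
  "scale_map Y D \<beta> \<alpha> a = (THE b. \<forall>x\<in>Y. scale_proj Y D \<alpha> x = a \<longrightarrow> b = scale_proj Y D \<beta> x)"

lemma scale_map_proj:
  fixes \<alpha> \<beta> :: "'k::linordered_field"
  assumes "0 < \<beta>" "\<beta> \<le> \<alpha>"
    and refl: "\<And>x. x \<in> Y \<Longrightarrow> D x x = 0"
    and nonneg: "\<And>x y. x \<in> Y \<Longrightarrow> y \<in> Y \<Longrightarrow> 0 \<le> D x y"
    and sym: "\<And>x y. x \<in> Y \<Longrightarrow> y \<in> Y \<Longrightarrow> D x y = D y x"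
    and triangle: "\<And>x y z. x \<in> Y \<Longrightarrow> y \<in> Y \<Longrightarrow> z \<in> Y \<Longrightarrow> D x z \<le> D x y + D y z"
    and "x \<in> Y"
  shows "scale_map Y D \<beta> \<alpha> (scale_proj Y D \<alpha> x) = scale_proj Y D \<beta> x"
proof -
  have half: "inf_small (\<beta> * D p r)"
    if "p \<in> Y" "q \<in> Y" "r \<in> Y" "inf_small (\<beta> * D p q)" "inf_small (\<beta> * D q r)" for p q r
    unfolding inf_small_def
  proof (intro allI impI)
    fix n :: nat
    assume n: "n \<ge> 1"
    then have "\<bar>\<beta> * D p q\<bar> < 1 / of_nat (2 * n)" "\<bar>\<beta> * D q r\<bar> < 1 / of_nat (2 * n)"
      using n that(4,5)[unfolded inf_small_def, rule_format, of "2 * n"] by simp_all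
    moreover have "\<beta> * D p r \<le> \<beta> * D p q + \<beta> * D q r"
      using triangle[OF that(1-3)] \<open>0 < \<beta>\<close> by (simp flip: distrib_left)
    moreover have "1 / of_nat (2 * n) + 1 / of_nat (2 * n) = (1 / of_nat n :: 'k)"
      using n by (simp add: field_simps)
    moreover have "0 \<le> \<beta> * D p r"
      using nonneg that \<open>0 < \<beta>\<close> by simp
    ultimately show "\<bar>\<beta> * D p r\<bar> < 1 / of_nat n"
      by (simp add: abs_if split: if_splits)
  qed
  have "scale_proj Y D \<beta> x = scale_proj Y D \<beta> y"
    if y: "y \<in> Y" "scale_proj Y D \<alpha> y = scale_proj Y D \<alpha> x" for y
  proof -
    have "y \<in> scale_proj Y D \<alpha> y"
      using y(1) refl by (simp add: scale_proj_def scale_rel_def inf_small_def)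
    then have "inf_small (\<alpha> * D x y)"
      unfolding y(2) by (simp add: scale_proj_def scale_rel_def)
    moreover have "\<bar>\<beta> * D x y\<bar> \<le> \<bar>\<alpha> * D x y\<bar>"
      using assms(1,2) by (simp add: abs_mult mult_right_mono)
    ultimately have "inf_small (\<beta> * D x y)"
      unfolding inf_small_def using order.strict_trans1 by blast
    then show ?thesis
      using half[of x y] half[of y x] sym[of x y] y(1) \<open>x \<in> Y\<close>
      by (auto simp: scale_proj_def scale_rel_def)
  qed
  then show ?thesis
    unfolding scale_map_def using \<open>x \<in> Y\<close> by (intro the_equality) (simp, blast)
qed

end

theory Submission
  imports Defs
begin

text \<open>
  Transfer makes \<open>\<rho>\<close> an embedding of ordered fields and \<open>D\<close> a pseudometric on \<open>Y\<close> with values in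
  the nonstandard reals; nothing else about the extension matters.  Writing \<open>\<gamma> = \<beta> / \<alpha>\<close>, everything
  is computed on representatives in \<open>Y\<close>.  If \<open>\<alpha> * D x y\<close> is limited, it differs from its standard
  part by an infinitesimal, which stays infinitesimal after multiplication by the limited \<open>\<gamma>\<close>.  If
  \<open>\<alpha> * D x y\<close> is infinitely large, the galaxy of \<open>\<alpha> * D x y\<close> is multiplied by \<open>\<gamma>\<close> either into the
  infinitely large elements (\<open>\<gamma>\<close> not infinitesimal) or into a set of infinitesimal diameter.
\<close>

section \<open>Infinitesimals and standard parts\<close>

lemma inf_small_mono: "inf_small t \<Longrightarrow> \<bar>s\<bar> \<le> \<bar>t\<bar> \<Longrightarrow> inf_small s"
  unfolding inf_small_def using order.strict_trans1 by blast

lemma inf_small_0 [simp]: "inf_small 0"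
  by (simp add: inf_small_def)

lemma inf_small_uminus [simp]: "inf_small (- s) \<longleftrightarrow> inf_small s"
  by (simp add: inf_small_def)

lemma inf_small_diff_commute: "inf_small (s - t) \<longleftrightarrow> inf_small (t - s)"
  by (simp add: inf_small_def abs_minus_commute)

lemma inf_small_imp_limited: "inf_small s \<Longrightarrow> limited s"
proof -
  assume "inf_small s"
  then have "\<bar>s\<bar> < 1 / of_nat 1"
    unfolding inf_small_def by blast
  then have "\<bar>s\<bar> \<le> of_nat 1"
    by simp
  then show ?thesis
    unfolding limited_iff by blast
qed

lemma inf_small_add:
  fixes s t :: "'k::linordered_field"
  assumes "inf_small s" "inf_small t"
  shows "inf_small (s + t)"
  unfolding inf_small_def
proof (intro allI impI)
  fix n :: nat
  assume n: "n \<ge> 1"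
  then have "\<bar>s\<bar> < 1 / of_nat (2 * n)" "\<bar>t\<bar> < 1 / of_nat (2 * n)"
    using assms[unfolded inf_small_def, rule_format, of "2 * n"] by simp_all
  moreover have "1 / of_nat (2 * n) + 1 / of_nat (2 * n) = (1 / of_nat n :: 'k)"
    using n by (simp add: field_simps)
  ultimately show "\<bar>s + t\<bar> < 1 / of_nat n"
    using abs_triangle_ineq[of s t] by linarith
qed

lemma inf_small_diff: "inf_small s \<Longrightarrow> inf_small t \<Longrightarrow> inf_small (s - t)"
  using inf_small_add[of s "- t"] by simp

text \<open>If |s| is at most an integer M, the bound 1/n for \<open>s * t\<close> follows from the
  bound 1/(M n) for \<open>t\<close>.\<close>

lemma inf_small_mult_limited:
  fixes s t :: "'k::linordered_field"
  assumes "limited s" "inf_small t"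
  shows "inf_small (s * t)"
  unfolding inf_small_def
proof (intro allI impI)
  fix n :: nat
  assume n: "n \<ge> 1"
  obtain m :: nat where "\<bar>s\<bar> \<le> of_nat m"
    using assms(1) limited_iff by blast
  \<comment> \<open>The successor makes the bound positive, as the strict multiplication and the
    cancellation below require.\<close>
  then have m: "\<bar>s\<bar> \<le> of_nat (Suc m)"
    using order_trans by fastforce
  have pos: "(0::'k) < of_nat (Suc m)"
    by (rule of_nat_0_less_iff[THEN iffD2]) simp
  have "\<bar>t\<bar> < 1 / of_nat (Suc m * n)"
    using assms(2) n unfolding inf_small_def by (metis One_nat_def Suc_le_eq mult_pos_pos zero_less_Suc)
  then have "of_nat (Suc m) * \<bar>t\<bar> < of_nat (Suc m) * (1 / of_nat (Suc m * n))"
    using pos by (rule mult_strict_left_mono)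
  also have "\<dots> = 1 / of_nat n"
    using pos n unfolding of_nat_mult by (simp add: field_simps del: of_nat_Suc)
  finally have "of_nat (Suc m) * \<bar>t\<bar> < 1 / of_nat n" .
  moreover have "\<bar>s * t\<bar> \<le> of_nat (Suc m) * \<bar>t\<bar>"
    unfolding abs_mult using m by (rule mult_right_mono) simp
  ultimately show "\<bar>s * t\<bar> < 1 / of_nat n"
    by simp
qed

text \<open>A non-infinitesimal \<open>s\<close> has 1/n \<le> |s| for some n \<ge> 1, whence |t|
  \<le> n |s t|. Read contrapositively, a non-infinitesimal factor keeps infinitely large elements
  infinitely large.\<close>

lemma limited_divide_not_inf_small:
  fixes s t :: "'k::linordered_field"
  assumes "limited (s * t)" "\<not> inf_small s"
  shows "limited t"
proof -
  obtain n :: nat where n: "n \<ge> 1" "1 / of_nat n \<le> \<bar>s\<bar>"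
    using assms(2) unfolding inf_small_def by (auto simp: not_less)
  then have pos: "(0::'k) < of_nat n"
    by simp
  then have "1 \<le> of_nat n * \<bar>s\<bar>"
    using n(2) by (simp add: field_simps)
  then have "1 * \<bar>t\<bar> \<le> of_nat n * \<bar>s\<bar> * \<bar>t\<bar>"
    by (rule mult_right_mono) simp
  then have "\<bar>t\<bar> \<le> \<bar>of_nat n * (s * t)\<bar>"
    by (simp add: abs_mult mult.assoc)
  moreover have "limited (of_nat n :: 'k)"
    unfolding limited_iff by (metis abs_of_nat order_refl)
  ultimately show ?thesis
    using limited_mono limited_mult assms(1) by blast
qed

lemma le_imp_Gal_le: "s \<le> t \<Longrightarrow> Gal s \<le> Gal t"
  by transfer simp

lemma Gal_add: "Gal (s + t) = Gal s + Gal t"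
  by transfer (simp add: limited_0)

lemma Gal_eq_0_iff: "Gal s = 0 \<longleftrightarrow> limited s"
  by transfer simp

section \<open>The embedded reals and the standard part map\<close>

locale real_embedding =
  fixes \<rho> :: "real \<Rightarrow> 'k::linordered_field"
  assumes \<rho>_add: "\<rho> (a + b) = \<rho> a + \<rho> b"
    and \<rho>_mult: "\<rho> (a * b) = \<rho> a * \<rho> b"
    and \<rho>_le_iff [simp]: "\<rho> a \<le> \<rho> b \<longleftrightarrow> a \<le> b"
begin

lemma \<rho>_less_iff [simp]: "\<rho> a < \<rho> b \<longleftrightarrow> a < b"
  using \<rho>_le_iff[of b a] by (simp add: not_le[symmetric] del: \<rho>_le_iff)

lemma \<rho>_0 [simp]: "\<rho> 0 = 0"
  using \<rho>_add[of 0 0] by simp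

text \<open>\<open>\<rho> 1\<close> is idempotent, and nonzero because it lies above
  \<open>\<rho> 0 = 0\<close>.\<close>

lemma \<rho>_1 [simp]: "\<rho> 1 = 1"
  using \<rho>_mult[of 1 1] \<rho>_less_iff[of 0 1] by (simp del: \<rho>_less_iff)

lemma \<rho>_uminus: "\<rho> (- a) = - \<rho> a"
  using \<rho>_add[of a "- a"] by (simp add: eq_neg_iff_add_eq_0 add.commute)

lemma \<rho>_diff: "\<rho> (a - b) = \<rho> a - \<rho> b"
  using \<rho>_add[of a "- b"] by (simp add: \<rho>_uminus)

lemma \<rho>_of_nat: "\<rho> (of_nat n) = of_nat n"
  by (induction n) (simp_all add: \<rho>_add)

lemma \<rho>_inverse_of_nat: "\<rho> (1 / of_nat n) = 1 / of_nat n"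
proof (cases "n = 0")
  case False
  then have "of_nat n * \<rho> (1 / of_nat n) = 1"
    using \<rho>_mult[of "of_nat n" "1 / of_nat n"] by (simp add: \<rho>_of_nat)
  with False show ?thesis
    by (simp add: field_simps)
qed simp

lemma limited_\<rho>: "limited (\<rho> r)"
proof -
  obtain n :: nat where "\<bar>r\<bar> \<le> of_nat n"
    using real_arch_simple by blast
  then have "\<rho> r \<le> \<rho> (of_nat n)" "\<rho> (- of_nat n) \<le> \<rho> r"
    by auto
  then show ?thesis
    unfolding limited_iff \<rho>_uminus \<rho>_of_nat by (metis abs_le_iff minus_le_iff)
qed

text \<open>By the Archimedean property a nonzero real exceeds some 1/n in absolute value, and
  \<open>\<rho>\<close> sends 1/n to 1/n. Uniqueness of standard parts rests on this.\<close>

lemma inf_small_\<rho>: "inf_small (\<rho> r) \<Longrightarrow> r = 0"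
proof (rule ccontr)
  assume *: "inf_small (\<rho> r)" "r \<noteq> 0"
  then obtain n :: nat where n: "n \<noteq> 0" "1 / of_nat n < \<bar>r\<bar>"
    using reals_Archimedean[of "\<bar>r\<bar>"] by (auto simp: inverse_eq_divide simp flip: of_nat_Suc)
  have "\<rho> (1 / of_nat n) < \<rho> \<bar>r\<bar>"
    using n by simp
  moreover have "\<rho> \<bar>r\<bar> \<le> \<bar>\<rho> r\<bar>"
    by (cases "r \<ge> 0") (simp_all add: \<rho>_uminus abs_ge_minus_self)
  moreover have "\<bar>\<rho> r\<bar> < 1 / of_nat n"
    using *(1) n unfolding inf_small_def by simp
  ultimately show False
    by (simp add: \<rho>_inverse_of_nat)
qed

lemma st_eqI:
  assumes "inf_small (s - \<rho> r)"
  shows "st \<rho> s = ereal r"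
proof -
  have "limited s"
    using limited_add[OF inf_small_imp_limited[OF assms] limited_\<rho>[of r]] by simp
  moreover have "(THE r. inf_small (s - \<rho> r)) = r"
  proof (rule the_equality)
    fix q
    assume "inf_small (s - \<rho> q)"
    then have "inf_small (\<rho> q - s)"
      by (simp add: inf_small_diff_commute)
    then have "inf_small (\<rho> (q - r))"
      using inf_small_add[OF _ assms] by (fastforce simp: \<rho>_diff)
    then show "q = r"
      using inf_small_\<rho> by fastforce
  qed fact
  ultimately show ?thesis
    by (simp add: st_def)
qed

text \<open>Completeness of the reals enters here: the standard part is the supremum of the reals
  below \<open>s\<close>, a set that is nonempty and bounded because \<open>s\<close> is
  limited.\<close>

lemma limited_imp_standard_part:
  assumes "limited s"
  obtains r where "inf_small (s - \<rho> r)"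
proof -
  define S where "S = {q. \<rho> q \<le> s}"
  obtain m :: nat where m: "\<bar>s\<bar> \<le> of_nat m"
    using assms limited_iff by blast
  have "s \<le> of_nat m" "- of_nat m \<le> s"
    using m by (simp_all add: abs_le_iff minus_le_iff)
  then have "- of_nat m \<in> S"
    by (simp add: S_def \<rho>_uminus \<rho>_of_nat)
  have "q \<le> of_nat m" if "q \<in> S" for q
  proof -
    have "\<rho> q \<le> \<rho> (of_nat m)"
      using that \<open>s \<le> of_nat m\<close> unfolding S_def \<rho>_of_nat by auto
    then show ?thesis
      by simp
  qed
  then have bdd: "bdd_above S"
    by (rule bdd_aboveI)
  define r where "r = Sup S"
  have "inf_small (s - \<rho> r)"
    unfolding inf_small_def
  proof (intro allI impI)
    fix n :: nat
    assume n: "n \<ge> 1"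
    define e :: real where "e = 1 / of_nat n"
    have e: "0 < e"
      using n by (simp add: e_def)
    have "r + e / 2 \<notin> S"
      using cSup_upper[OF _ bdd, of "r + e / 2"] e by (auto simp: r_def)
    then have "s < \<rho> (r + e / 2)"
      by (simp add: S_def)
    also have "\<dots> < \<rho> (r + e)"
      using e by simp
    finally have up: "s < \<rho> r + \<rho> e"
      by (simp add: \<rho>_add)
    obtain q where "q \<in> S" "r - e < q"
      using less_cSupD[of S "r - e"] \<open>- of_nat m \<in> S\<close> e by (auto simp: r_def)
    then have "\<rho> (r - e) < s"
      using \<rho>_less_iff[of "r - e" q] unfolding S_def by (auto simp del: \<rho>_less_iff)
    then have "\<bar>s - \<rho> r\<bar> < \<rho> e"
      using up by (simp add: \<rho>_diff abs_if)
    then show "\<bar>s - \<rho> r\<bar> < 1 / of_nat n"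
      by (simp add: e_def \<rho>_inverse_of_nat)
  qed
  then show thesis
    by (rule that)
qed

text \<open>A real infinitely close to \<open>t\<close> is infinitely close to \<open>s\<close>. In
  the infinitely large case the sign cannot change, since opposite signs would give |s| \<le> |s -
  t|, which is limited.\<close>

lemma st_cong:
  assumes "inf_small (s - t)"
  shows "st \<rho> s = st \<rho> t"
proof (cases "limited t")
  case True
  then obtain r where r: "inf_small (t - \<rho> r)"
    by (rule limited_imp_standard_part)
  then have "inf_small (s - \<rho> r)"
    using inf_small_add[OF assms r] by simp
  with r show ?thesis
    by (simp add: st_eqI)
next
  case False
  have l: "limited (s - t)"
    using assms by (rule inf_small_imp_limited)
  have s: "\<not> limited s"
    using False limited_minus[OF _ l, of s] by auto
  have "s > 0 \<longleftrightarrow> t > 0"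
  proof (rule ccontr)
    assume "(s > 0) \<noteq> (t > 0)"
    then have "\<bar>s\<bar> \<le> \<bar>s - t\<bar>"
      by auto
    with l s show False
      using limited_mono by blast
  qed
  with s False show ?thesis
    by (simp add: st_def)
qed

lemma st_infinite: "\<not> limited s \<Longrightarrow> 0 \<le> s \<Longrightarrow> st \<rho> s = \<infinity>"
  by (auto simp: st_def limited_0 order_le_less)

lemma st_less_infinity_iff: "0 \<le> s \<Longrightarrow> st \<rho> s < \<infinity> \<longleftrightarrow> limited s"
  by (auto simp: st_def limited_0)

lemma st_0 [simp]: "st \<rho> 0 = 0"
  by (simp add: st_eqI[of 0 0] zero_ereal_def)

lemma st_mono:
  assumes "s \<le> t"
  shows "st \<rho> s \<le> st \<rho> t"
proof -
  \<comment> \<open>If \<open>t\<close> is infinitely large and not positive, then |t| \<le> |s|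
    leads to the third case; if \<open>s\<close> is infinitely large and positive, so is
    \<open>t\<close>.\<close>
  consider "limited s" "limited t" | "\<not> limited t" "t > 0" | "\<not> limited s" "s \<le> 0"
    using assms limited_mono[of t s] limited_mono[of s t] by fastforce
  then show ?thesis
  proof cases
    case 1
    then obtain q r where qr: "inf_small (s - \<rho> q)" "inf_small (t - \<rho> r)"
      using limited_imp_standard_part by metis
    \<comment> \<open>Otherwise the positive element \<open>\<rho> (q - r)\<close> would lie below a
      difference of two infinitesimals.\<close>
    have "q \<le> r"
    proof (rule ccontr)
      assume "\<not> q \<le> r"
      then have "\<rho> r < \<rho> q"
        by simp
      then have "\<bar>\<rho> (q - r)\<bar> \<le> \<bar>(t - \<rho> r) - (s - \<rho> q)\<bar>"
        using assms by (simp add: \<rho>_diff)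
      moreover have "inf_small ((t - \<rho> r) - (s - \<rho> q))"
        using inf_small_diff qr by blast
      ultimately have "q - r = 0"
        using inf_small_mono inf_small_\<rho> by blast
      with \<open>\<not> q \<le> r\<close> show False
        by simp
    qed
    with qr show ?thesis
      by (simp add: st_eqI)
  qed (simp_all add: st_def)
qed

lemma st_nonneg: "0 \<le> s \<Longrightarrow> 0 \<le> st \<rho> s"
  using st_mono[of 0 s] by simp

text \<open>For nonnegative elements the sum dominates each summand, so one infinitely large summand
  makes both sides infinite, and opposite infinities never meet.\<close>

lemma st_add:
  assumes "0 \<le> s" "0 \<le> t"
  shows "st \<rho> (s + t) = st \<rho> s + st \<rho> t"
proof (cases "limited s \<and> limited t")
  case True
  then obtain q r where qr: "inf_small (s - \<rho> q)" "inf_small (t - \<rho> r)"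
    using limited_imp_standard_part by metis
  have "inf_small (s + t - \<rho> (q + r))"
    using inf_small_add[OF qr] by (simp add: \<rho>_add algebra_simps)
  with qr show ?thesis
    by (simp add: st_eqI)
next
  case False
  then have "\<not> limited (s + t)"
    using limited_mono[of "s + t" s] limited_mono[of "s + t" t] assms by auto
  then have "st \<rho> (s + t) = \<infinity>"
    using assms by (simp add: st_infinite)
  moreover have "st \<rho> s = \<infinity> \<or> st \<rho> t = \<infinity>"
    using False assms st_infinite by blast
  moreover have "st \<rho> s \<noteq> - \<infinity>" "st \<rho> t \<noteq> - \<infinity>"
    using st_nonneg assms by force+
  ultimately show ?thesis
    by auto
qed

lemma st_eq_0_iff: "st \<rho> s = 0 \<longleftrightarrow> inf_small s"
proof
  assume *: "st \<rho> s = 0"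
  then have "limited s"
    by (auto simp: st_def split: if_splits)
  then obtain r where "inf_small (s - \<rho> r)"
    by (rule limited_imp_standard_part)
  with st_eqI * show "inf_small s"
    by fastforce
next
  assume "inf_small s"
  then show "st \<rho> s = 0"
    using st_cong[of s 0] by simp
qed

lemma inf_small_minus_real_st:
  assumes "limited s"
  shows "inf_small (s - \<rho> (real_of_ereal (st \<rho> s)))"
proof -
  obtain r where "inf_small (s - \<rho> r)"
    using assms by (rule limited_imp_standard_part)
  then show ?thesis
    by (simp add: st_eqI)
qed

text \<open>The finite distances in \<open>contraction\<close> are themselves standard parts.
  Replacing \<open>s\<close> by its standard part costs an infinitesimal, which the limited factor
  keeps infinitesimal.\<close>

lemma st_mult_limited:
  assumes "limited \<gamma>" "limited s"
  shows "st \<rho> (\<gamma> * \<rho> (real_of_ereal (st \<rho> s))) = st \<rho> (\<gamma> * s)"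
  using inf_small_mult_limited[OF assms(1) inf_small_minus_real_st[OF assms(2)]]
  by (intro st_cong[symmetric]) (simp add: right_diff_distrib)

lemma st_set_gal_cdot:
  assumes \<gamma>: "limited \<gamma>" "0 < \<gamma>" and t: "\<not> limited t" "0 \<le> t"
  shows "st_set \<rho> (gal_cdot \<gamma> (Gal t)) = st \<rho> (\<gamma> * t)"
proof -
  have "st \<rho> (\<gamma> * s) = st \<rho> (\<gamma> * t)" if s: "limited (s - t)" for s
  proof (cases "inf_small \<gamma>")
    case True
    then have "inf_small (\<gamma> * (s - t))"
      using inf_small_mult_limited[OF s True] by (simp add: mult.commute)
    then show ?thesis
      by (intro st_cong) (simp add: right_diff_distrib)
  next
    case False
    \<comment> \<open>Both \<open>s\<close> and \<open>t\<close> turn out nonnegative and infinitely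
      large, and so do their multiples by the non-infinitesimal \<open>\<gamma>\<close>; hence both
      standard parts are \<infinity>.\<close>
    have "\<not> limited s"
      using limited_minus[OF _ s, of s] t by auto
    moreover have "0 \<le> s"
    proof (rule ccontr)
      assume "\<not> 0 \<le> s"
      then have "\<bar>t\<bar> \<le> \<bar>s - t\<bar>"
        using t by auto
      then show False
        using limited_mono s t by blast
    qed
    ultimately show ?thesis
      using limited_divide_not_inf_small[of \<gamma>] False t \<gamma> by (metis st_infinite mult_nonneg_nonneg less_imp_le)
  qed
  then have "\<forall>s\<in>gal_cdot \<gamma> (Gal t). st \<rho> s = st \<rho> (\<gamma> * t)"
    by (auto simp: gal_cdot_def Gal_eq_iff)
  \<comment> \<open>A member of the set ensures that only one value satisfies the definite
    description in \<open>st_set\<close>.\<close>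
  moreover have "\<gamma> * t \<in> gal_cdot \<gamma> (Gal t)"
    by (auto simp: gal_cdot_def)
  ultimately show ?thesis
    unfolding st_set_def by (intro the_equality) (assumption, metis)
qed

end

section \<open>Scalings of a pseudometric\<close>

text \<open>Separation of points is produced later by the quotient by \<open>scale_rel\<close>, so a
  pseudometric is the natural input.\<close>

locale hyperreal_pseudometric = real_embedding \<rho>
  for \<rho> :: "real \<Rightarrow> 'k::linordered_field" +
  fixes Y :: "'y set" and D :: "'y \<Rightarrow> 'y \<Rightarrow> 'k"
  assumes D_refl: "x \<in> Y \<Longrightarrow> D x x = 0"
    and D_nonneg: "x \<in> Y \<Longrightarrow> y \<in> Y \<Longrightarrow> 0 \<le> D x y"
    and D_sym: "x \<in> Y \<Longrightarrow> y \<in> Y \<Longrightarrow> D x y = D y x"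
    and D_triangle: "x \<in> Y \<Longrightarrow> y \<in> Y \<Longrightarrow> z \<in> Y \<Longrightarrow> D x z \<le> D x y + D y z"
begin

text \<open>Two triangle inequalities in each direction. The scaled form of this estimate gives
  independence of representatives for both \<open>gdist\<close> and \<open>galdist\<close>.\<close>

lemma D_diff_le:
  assumes "x \<in> Y" "y \<in> Y" "x' \<in> Y" "y' \<in> Y"
  shows "\<bar>D x y - D x' y'\<bar> \<le> D x x' + D y y'"
proof -
  have "D x y \<le> D x x' + D x' y" "D x' y \<le> D x' y' + D y' y"
    "D x' y' \<le> D x' x + D x y'" "D x y' \<le> D x y + D y y'" "D x' x = D x x'" "D y' y = D y y'"
    using assms D_triangle D_sym by blast+
  then show ?thesis
    by (simp add: abs_le_iff)
qed

section \<open>The galactic space of a single scaling\<close>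

context
  fixes \<alpha> :: 'k
  assumes pos: "0 < \<alpha>"
begin

abbreviation (input) "G \<equiv> scaling \<rho> Y D \<alpha>"
abbreviation (input) "proj \<equiv> scale_proj Y D \<alpha>"
abbreviation (input) "component x \<equiv> comp_of (points G) (gdist G) (proj x)"

lemma scaled_nonneg: "x \<in> Y \<Longrightarrow> y \<in> Y \<Longrightarrow> 0 \<le> \<alpha> * D x y"
  using pos D_nonneg by simp

lemma scaled_triangle:
  "x \<in> Y \<Longrightarrow> y \<in> Y \<Longrightarrow> z \<in> Y \<Longrightarrow> \<alpha> * D x z \<le> \<alpha> * D x y + \<alpha> * D y z"
  using pos D_triangle by (simp flip: distrib_left)

text \<open>The absolute value on the right matches the shape of \<open>inf_small_mono\<close> and
  \<open>limited_mono\<close>.\<close>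

lemma scaled_diff_le:
  assumes "x \<in> Y" "y \<in> Y" "x' \<in> Y" "y' \<in> Y"
  shows "\<bar>\<alpha> * D x y - \<alpha> * D x' y'\<bar> \<le> \<bar>\<alpha> * D x x' + \<alpha> * D y y'\<bar>"
proof -
  have "\<alpha> * \<bar>D x y - D x' y'\<bar> \<le> \<alpha> * (D x x' + D y y')"
    using D_diff_le[OF assms] pos by simp
  then show ?thesis
    using pos by (simp add: abs_mult flip: right_diff_distrib distrib_left)
qed

lemma equiv_scale_rel: "equiv Y (scale_rel Y D \<alpha>)"
proof (rule equivI)
  show "scale_rel Y D \<alpha> \<subseteq> Y \<times> Y"
    by (auto simp: scale_rel_def)
  show "refl_on Y (scale_rel Y D \<alpha>)"
    by (auto simp: refl_on_def scale_rel_def D_refl)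
  show "sym (scale_rel Y D \<alpha>)"
    by (auto simp: sym_def scale_rel_def D_sym)
  show "trans (scale_rel Y D \<alpha>)"
  proof (rule transI)
    fix x y z
    assume "(x, y) \<in> scale_rel Y D \<alpha>" "(y, z) \<in> scale_rel Y D \<alpha>"
    then have Y: "x \<in> Y" "y \<in> Y" "z \<in> Y" and "inf_small (\<alpha> * D x y + \<alpha> * D y z)"
      by (auto simp: scale_rel_def inf_small_add)
    moreover have "\<bar>\<alpha> * D x z\<bar> \<le> \<bar>\<alpha> * D x y + \<alpha> * D y z\<bar>"
      using scaled_triangle scaled_nonneg Y by (simp add: abs_of_nonneg)
    ultimately show "(x, z) \<in> scale_rel Y D \<alpha>"
      using inf_small_mono by (auto simp: scale_rel_def)
  qed
qed

lemma proj_eq_iff: "x \<in> Y \<Longrightarrow> y \<in> Y \<Longrightarrow> proj x = proj y \<longleftrightarrow> inf_small (\<alpha> * D x y)"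
  unfolding scale_proj_def by (subst eq_equiv_class_iff[OF equiv_scale_rel]) (auto simp: scale_rel_def)

lemma points_scaling: "points G = proj ` Y"
  by (auto simp: scaling_def quotient_def scale_proj_def)

text \<open>Another choice of representatives changes the scaled distance by an infinitesimal, which
  \<open>st\<close> ignores; so the definite description has a value.\<close>

lemma gdist_scaling:
  assumes "x \<in> Y" "y \<in> Y"
  shows "gdist G (proj x) (proj y) = st \<rho> (\<alpha> * D x y)"
proof -
  have "st \<rho> (\<alpha> * D x y) = st \<rho> (\<alpha> * D x' y')"
    if "x' \<in> Y" "y' \<in> Y" "proj x' = proj x" "proj y' = proj y" for x' y'
  proof -
    have "inf_small (\<alpha> * D x x')" "inf_small (\<alpha> * D y y')"
      using that assms proj_eq_iff by metis+
    then have "inf_small (\<alpha> * D x y - \<alpha> * D x' y')"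
      using scaled_diff_le[OF assms that(1,2)] inf_small_add inf_small_mono by blast
    then show ?thesis
      by (rule st_cong)
  qed
  then show ?thesis
    unfolding scaling_def galactic.simps using assms by (intro the_equality) blast+
qed

lemma gdist_scaling_finite_iff:
  "x \<in> Y \<Longrightarrow> y \<in> Y \<Longrightarrow> gdist G (proj x) (proj y) < \<infinity> \<longleftrightarrow> limited (\<alpha> * D x y)"
  by (simp add: gdist_scaling st_less_infinity_iff scaled_nonneg del: ereal_infty_less)

lemma metric_rule_gdist: "metric_rule (points G) (gdist G)"
  unfolding metric_rule_def points_scaling
proof (intro conjI ballI impI)
  fix a b c
  assume "a \<in> proj ` Y" "b \<in> proj ` Y" "c \<in> proj ` Y"
  then obtain x y z where "x \<in> Y" "y \<in> Y" "z \<in> Y" "a = proj x" "b = proj y" "c = proj z"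
    by blast
  then show "gdist G a c \<le> gdist G a b + gdist G b c"
    using scaled_nonneg scaled_triangle by (auto simp: gdist_scaling st_mono simp flip: st_add)
next
  fix a b
  assume ab: "a \<in> proj ` Y" "b \<in> proj ` Y" "a \<noteq> b"
  then obtain x y where xy: "x \<in> Y" "y \<in> Y" "a = proj x" "b = proj y"
    by blast
  \<comment> \<open>A standard part vanishes only on infinitesimals, that is, only when the two
    classes coincide.\<close>
  then have "st \<rho> (\<alpha> * D y x) \<noteq> 0" "0 \<le> st \<rho> (\<alpha> * D y x)"
    using ab(3) by (auto simp: st_eq_0_iff proj_eq_iff D_sym scaled_nonneg st_nonneg)
  with xy show "gdist G b a > 0"
    by (simp add: gdist_scaling)
  from xy show "gdist G a b = gdist G b a"
    by (simp add: gdist_scaling D_sym)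
qed (auto simp: gdist_scaling D_refl)

lemma limited_scaled_trans:
  assumes "x \<in> Y" "y \<in> Y" "z \<in> Y" "limited (\<alpha> * D x y)" "limited (\<alpha> * D y z)"
  shows "limited (\<alpha> * D x z)"
proof -
  have "\<bar>\<alpha> * D x z\<bar> \<le> \<bar>\<alpha> * D x y + \<alpha> * D y z\<bar>"
    using scaled_triangle scaled_nonneg assms by (simp add: abs_of_nonneg)
  then show ?thesis
    using assms limited_add limited_mono by blast
qed

lemma comp_rel_scaling_iff:
  "x \<in> Y \<Longrightarrow> y \<in> Y \<Longrightarrow> (proj x, proj y) \<in> comp_rel (points G) (gdist G) \<longleftrightarrow> limited (\<alpha> * D x y)"
  by (auto simp: comp_rel_def points_scaling gdist_scaling_finite_iff simp del: ereal_infty_less)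

lemma mem_comp_scaling_iff:
  "x \<in> Y \<Longrightarrow> y \<in> Y \<Longrightarrow> proj y \<in> component x \<longleftrightarrow> limited (\<alpha> * D x y)"
  by (simp add: comp_of_def comp_rel_scaling_iff)

lemma comp_scaling_subset: "component x \<subseteq> proj ` Y"
  by (auto simp: comp_of_def comp_rel_def points_scaling)

lemma comps_scaling: "comps G = component ` Y"
  by (auto simp: metric_comps_def quotient_def comp_of_def points_scaling)

text \<open>Limited scaled distance is symmetric and transitive on \<open>Y\<close>, and every
  component consists of projections of points of \<open>Y\<close>, so comparing memberships of such
  projections is enough.\<close>

lemma comp_scaling_eq_iff:
  assumes "x \<in> Y" "y \<in> Y"
  shows "component x = component y \<longleftrightarrow> limited (\<alpha> * D x y)"
proof
  assume "component x = component y"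
  moreover have "proj y \<in> component y"
    using assms by (simp add: mem_comp_scaling_iff D_refl limited_0)
  ultimately show "limited (\<alpha> * D x y)"
    using assms mem_comp_scaling_iff by blast
next
  assume *: "limited (\<alpha> * D x y)"
  have "proj z \<in> component x \<longleftrightarrow> proj z \<in> component y" if "z \<in> Y" for z
    using that assms * limited_scaled_trans[of x y z] limited_scaled_trans[of y x z]
    by (auto simp: mem_comp_scaling_iff D_sym[of y x])
  then show "component x = component y"
    using comp_scaling_subset by blast
qed

text \<open>Moving representatives inside their components changes the scaled distance by a limited
  amount, which \<open>Gal\<close> ignores.\<close>

lemma galdist_scaling:
  assumes "x \<in> Y" "y \<in> Y"
  shows "galdist G (component x) (component y) = Gal (\<alpha> * D x y)"
proof -
  have wd: "Gal (\<alpha> * D x y) = Gal (\<alpha> * D x' y')"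
    if "x' \<in> Y" "y' \<in> Y" "proj x' \<in> component x" "proj y' \<in> component y" for x' y'
  proof -
    have "limited (\<alpha> * D x x')" "limited (\<alpha> * D y y')"
      using that assms mem_comp_scaling_iff by blast+
    then show ?thesis
      unfolding Gal_eq_iff using scaled_diff_le[OF assms that(1,2)] limited_add limited_mono by blast
  qed
  have mem: "proj x \<in> component x" "proj y \<in> component y"
    using assms by (simp_all add: mem_comp_scaling_iff D_refl limited_0)
  \<comment> \<open>With \<open>E\<close> and \<open>E'\<close> general, only the outer
    \<open>scaling\<close> is unfolded; the copies inside \<open>component\<close> stay folded when
    \<open>eq\<close> is applied.\<close>
  have eq: "galdist G E E' = (THE \<tau>. \<forall>x\<in>Y. \<forall>y\<in>Y.
      proj x \<in> E \<and> proj y \<in> E' \<longrightarrow> \<tau> = Gal (\<alpha> * D x y))" for E E'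
    by (simp add: scaling_def)
  show ?thesis
    unfolding eq
  proof (rule the_equality)
    show "\<forall>x'\<in>Y. \<forall>y'\<in>Y. proj x' \<in> component x \<and> proj y' \<in> component y \<longrightarrow>
        Gal (\<alpha> * D x y) = Gal (\<alpha> * D x' y')"
      using wd by blast
  next
    fix \<tau>
    assume "\<forall>x'\<in>Y. \<forall>y'\<in>Y. proj x' \<in> component x \<and> proj y' \<in> component y \<longrightarrow>
        \<tau> = Gal (\<alpha> * D x' y')"
    then show "\<tau> = Gal (\<alpha> * D x y)"
      using assms mem by blast
  qed
qed

lemma metric_rule_galdist: "metric_rule (comps G) (galdist G)"
  unfolding metric_rule_def comps_scaling
proof (intro conjI ballI impI)
  fix a b c
  assume "a \<in> component ` Y" "b \<in> component ` Y" "c \<in> component ` Y"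
  then obtain x y z where "x \<in> Y" "y \<in> Y" "z \<in> Y" "a = component x" "b = component y" "c = component z"
    by blast
  then show "galdist G a c \<le> galdist G a b + galdist G b c"
    using scaled_triangle by (auto simp: galdist_scaling intro!: le_imp_Gal_le simp flip: Gal_add)
next
  fix a b
  assume ab: "a \<in> component ` Y" "b \<in> component ` Y" "a \<noteq> b"
  then obtain x y where xy: "x \<in> Y" "y \<in> Y" "a = component x" "b = component y"
    by blast
  \<comment> \<open>Distinct components are at infinitely large scaled distance, which means a
    nonzero galaxy.\<close>
  have "Gal (\<alpha> * D y x) \<noteq> 0"
    using ab(3) xy by (auto simp: Gal_eq_0_iff comp_scaling_eq_iff D_sym)
  moreover have "0 \<le> Gal (\<alpha> * D y x)"
    using le_imp_Gal_le[OF scaled_nonneg, of y x] xy by (simp add: Gal_eq_0_iff[THEN iffD2] limited_0)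
  ultimately show "galdist G b a > 0"
    using xy by (simp add: galdist_scaling)
  from xy show "galdist G a b = galdist G b a"
    by (simp add: galdist_scaling D_sym)
qed (auto simp: galdist_scaling D_refl Gal_eq_0_iff limited_0)

lemma galactic_space_scaling: "galactic_space G"
  by (simp add: galactic_space_def metric_rule_gdist metric_rule_galdist)

end

section \<open>The map between two scalings\<close>

lemma image_comp_scale_map:
  assumes "0 < \<beta>" "\<beta> < \<alpha>" "x \<in> Y"
  defines "A \<equiv> scaling \<rho> Y D \<alpha>" and "B \<equiv> scaling \<rho> Y D \<beta>"
  shows "image_comp A (scale_map Y D \<beta> \<alpha>) (comp_of (points A) (gdist A) (scale_proj Y D \<alpha> x)) B =
    comp_of (points B) (gdist B) (scale_proj Y D \<beta> x)"
proof -
  let ?f = "scale_map Y D \<beta> \<alpha>" and ?a = "scale_proj Y D \<alpha>" and ?b = "scale_proj Y D \<beta>"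
  let ?C = "\<lambda>x. comp_of (points A) (gdist A) (?a x)" and ?C' = "\<lambda>x. comp_of (points B) (gdist B) (?b x)"
  have "0 < \<alpha>"
    using assms by simp
  note \<alpha> = mem_comp_scaling_iff[OF \<open>0 < \<alpha>\<close>, folded A_def]
    comp_scaling_subset[OF \<open>0 < \<alpha>\<close>, folded A_def]
  note \<beta> = mem_comp_scaling_iff[OF \<open>0 < \<beta>\<close>, folded B_def]
    comps_scaling[OF \<open>0 < \<beta>\<close>, folded B_def] comp_scaling_eq_iff[OF \<open>0 < \<beta>\<close>, folded B_def]
  have f: "?f (?a y) = ?b y" if "y \<in> Y" for y
    using that assms by (intro scale_map_proj D_refl D_nonneg D_sym D_triangle) auto
  show ?thesis
    unfolding image_comp_def
  proof (rule the_equality)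
    \<comment> \<open>Existence: passing to the smaller scale keeps limited distances limited, so
      the whole component lands in one component.\<close>
    have "?f c \<in> ?C' x" if c: "c \<in> ?C x" for c
    proof -
      obtain y where y: "y \<in> Y" "c = ?a y"
        using \<alpha>(2) c by blast
      then have "limited (\<alpha> * D x y)"
        using c \<alpha>(1) assms(3) by blast
      moreover have "\<bar>\<beta> * D x y\<bar> \<le> \<bar>\<alpha> * D x y\<bar>"
        using assms(1,2) by (simp add: abs_mult mult_right_mono)
      ultimately have "limited (\<beta> * D x y)"
        using limited_mono by blast
      then show ?thesis
        using y f \<beta>(1) assms(3) by simp
    qed
    then show "?C' x \<in> comps B \<and> ?f ` ?C x \<subseteq> ?C' x"
      using \<beta>(2) assms(3) by blast
  next
    fix E
    assume E: "E \<in> comps B \<and> ?f ` ?C x \<subseteq> E"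
    then have "E \<in> ?C' ` Y"
      by (simp only: \<beta>(2))
    then obtain z where z: "z \<in> Y" "E = ?C' z"
      by (rule imageE)
    \<comment> \<open>Uniqueness: the image of the class of \<open>x\<close> alone already decides
      which component \<open>E\<close> is.\<close>
    have "?a x \<in> ?C x"
      using assms(3) by (simp add: \<alpha>(1) D_refl limited_0)
    then have "?b x \<in> ?C' z"
      using E z f[OF assms(3)] by (metis image_subset_iff)
    then have "limited (\<beta> * D z x)"
      using \<beta>(1) z(1) assms(3) by blast
    then show "E = ?C' x"
      unfolding z(2) using \<beta>(3) z(1) assms(3) by blast
  qed
qed

theorem contraction_scale_map:
  assumes "0 < \<beta>" "\<beta> < \<alpha>"
  shows "contraction \<rho> (\<beta> / \<alpha>) (scaling \<rho> Y D \<alpha>) (scaling \<rho> Y D \<beta>) (scale_map Y D \<beta> \<alpha>)"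
proof -
  let ?A = "scaling \<rho> Y D \<alpha>" and ?B = "scaling \<rho> Y D \<beta>" and ?f = "scale_map Y D \<beta> \<alpha>"
  let ?a = "scale_proj Y D \<alpha>" and ?b = "scale_proj Y D \<beta>"
  let ?C = "\<lambda>x. comp_of (points ?A) (gdist ?A) (?a x)"
  define \<gamma> where "\<gamma> = \<beta> / \<alpha>"
  have "0 < \<alpha>"
    using assms by simp
  \<comment> \<open>All three equations of a contraction come down to this identity on
    representatives.\<close>
  have \<gamma>: "0 < \<gamma>" "\<gamma> * (\<alpha> * s) = \<beta> * s" for s
    using assms by (simp_all add: \<gamma>_def)
  have lim1: "limited (1::'k)"
    using limited_\<rho>[of 1] by simp
  moreover have "\<bar>\<gamma>\<bar> \<le> \<bar>1\<bar>"
    using assms by (simp add: \<gamma>_def)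
  ultimately have lim: "limited \<gamma>"
    using limited_mono by blast
  have f: "?f (?a y) = ?b y" if "y \<in> Y" for y
    using that assms by (intro scale_map_proj D_refl D_nonneg D_sym D_triangle) auto
  note A = points_scaling[OF \<open>0 < \<alpha>\<close>] gdist_scaling[OF \<open>0 < \<alpha>\<close>] galdist_scaling[OF \<open>0 < \<alpha>\<close>]
    comps_scaling[OF \<open>0 < \<alpha>\<close>]
  note B = points_scaling[OF \<open>0 < \<beta>\<close>] gdist_scaling[OF \<open>0 < \<beta>\<close>] galdist_scaling[OF \<open>0 < \<beta>\<close>]
  \<comment> \<open>Since \<open>st\<close> and \<open>Gal\<close> are monotone, this yields both
    morphism inequalities with the constant 1.\<close>
  have le: "\<beta> * D x y \<le> \<alpha> * D x y" if "x \<in> Y" "y \<in> Y" for x y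
    using that assms D_nonneg by (simp add: mult_right_mono)
  have gal: "galdist ?B (image_comp ?A ?f (?C x) ?B) (image_comp ?A ?f (?C y) ?B) = Gal (\<beta> * D x y)"
    if "x \<in> Y" "y \<in> Y" for x y
    using that assms by (simp add: image_comp_scale_map B(3))
  have "morphism \<rho> ?A ?B ?f"
    unfolding morphism_def
  proof (intro conjI)
    show "?f \<in> points ?A \<rightarrow> points ?B"
      by (auto simp: A(1) B(1) f)
    \<comment> \<open>\<open>\<gamma>\<close> itself need not do here: \<open>st (\<gamma> * r)\<close> may exceed \<open>\<gamma> * r\<close> by an infinitesimal.\<close>
    show "\<exists>\<gamma>. limited \<gamma> \<and> \<gamma> > 0 \<and>
      (\<forall>a\<in>points ?A. \<forall>b\<in>points ?A. gdist ?A a b < \<infinity> \<longrightarrow>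
        gdist ?B (?f a) (?f b) < \<infinity> \<and>
        \<rho> (real_of_ereal (gdist ?B (?f a) (?f b))) \<le> \<gamma> * \<rho> (real_of_ereal (gdist ?A a b))) \<and>
      (\<forall>E\<in>comps ?A. \<forall>E'\<in>comps ?A.
        galdist ?B (image_comp ?A ?f E ?B) (image_comp ?A ?f E' ?B) \<le> gal_bullet \<gamma> (galdist ?A E E'))"
    proof (intro exI[of _ 1] conjI ballI impI)
      fix a b
      assume "a \<in> points ?A" "b \<in> points ?A" and fin: "gdist ?A a b < \<infinity>"
      then obtain x y where xy: "x \<in> Y" "y \<in> Y" "a = ?a x" "b = ?a y"
        by (auto simp: A(1))
      have *: "gdist ?B (?f a) (?f b) \<le> gdist ?A a b"
        using xy le by (simp add: A(2) B(2) f st_mono)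
      then show "gdist ?B (?f a) (?f b) < \<infinity>"
        using fin by (rule order.strict_trans1)
      have "0 \<le> gdist ?B (?f a) (?f b)"
        using xy scaled_nonneg[OF assms(1)] by (simp add: B(2) f st_nonneg)
      then have "real_of_ereal (gdist ?B (?f a) (?f b)) \<le> real_of_ereal (gdist ?A a b)"
        using * fin by (intro real_of_ereal_positive_mono) auto
      then show "\<rho> (real_of_ereal (gdist ?B (?f a) (?f b))) \<le> 1 * \<rho> (real_of_ereal (gdist ?A a b))"
        by simp
    next
      fix E E'
      assume "E \<in> comps ?A" "E' \<in> comps ?A"
      then obtain x y where "x \<in> Y" "y \<in> Y" "E = ?C x" "E' = ?C y"
        by (auto simp: A(4))
      then show "galdist ?B (image_comp ?A ?f E ?B) (image_comp ?A ?f E' ?B) \<le> gal_bullet 1 (galdist ?A E E')"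
        using le by (simp add: gal A(3) gal_bullet_Gal[OF lim1] le_imp_Gal_le)
    qed (use lim1 in simp_all)
  qed (use galactic_space_scaling assms \<open>0 < \<alpha>\<close> in blast)+
  then show ?thesis
    unfolding contraction_def \<gamma>_def[symmetric]
  proof (intro conjI ballI impI)
    show "?f ` points ?A = points ?B"
      by (auto simp: A(1) B(1) f image_image)
  next
    fix a b
    assume "a \<in> points ?A" "b \<in> points ?A"
    then obtain x y where xy: "x \<in> Y" "y \<in> Y" "a = ?a x" "b = ?a y"
      by (auto simp: A(1))
    have nn: "0 \<le> \<alpha> * D x y"
      using xy scaled_nonneg[OF \<open>0 < \<alpha>\<close>] by simp
    show "gdist ?B (?f a) (?f b) = st \<rho> (\<gamma> * \<rho> (real_of_ereal (gdist ?A a b)))" if "gdist ?A a b < \<infinity>"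
    proof -
      have "limited (\<alpha> * D x y)"
        using that xy nn by (simp add: A(2) st_less_infinity_iff del: ereal_infty_less)
      then show ?thesis
        using xy by (simp add: A(2) B(2) f st_mult_limited[OF lim] \<gamma>)
    qed
    show "gdist ?B (?f a) (?f b) = st_set \<rho> (gal_cdot \<gamma>
        (galdist ?A (comp_of (points ?A) (gdist ?A) a) (comp_of (points ?A) (gdist ?A) b)))"
      if "gdist ?A a b = \<infinity>"
    proof -
      have "\<not> limited (\<alpha> * D x y)"
        using that xy nn st_less_infinity_iff[OF nn] by (simp add: A(2))
      then show ?thesis
        using xy nn by (simp add: A(3) B(2) f st_set_gal_cdot[OF lim \<gamma>(1)] \<gamma>(2))
    qed
  next
    fix E E'
    assume "E \<in> comps ?A" "E' \<in> comps ?A"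
    then obtain x y where "x \<in> Y" "y \<in> Y" "E = ?C x" "E' = ?C y"
      by (auto simp: A(4))
    then show "galdist ?B (image_comp ?A ?f E ?B) (image_comp ?A ?f E' ?B) = gal_bullet \<gamma> (galdist ?A E E')"
      by (simp add: gal A(3) gal_bullet_Gal[OF lim] \<gamma>(2))
  qed (use lim \<gamma> in simp_all)
qed

end

section \<open>Transfer\<close>

text \<open>The primitive connectives of \<open>fm\<close> are negation, conjunction and existence.
  The derived ones get their own \<open>sat\<close> rules, so that formulas evaluate directly to HOL
  quantifiers and implications.\<close>

definition fm_all :: "nat \<Rightarrow> 's fm \<Rightarrow> 's fm" where
  "fm_all n \<phi> = Neg (Ex n (Neg \<phi>))"

definition fm_imp :: "'s fm \<Rightarrow> 's fm \<Rightarrow> 's fm" where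
  "fm_imp \<phi> \<psi> = Neg (Conj \<phi> (Neg \<psi>))"

lemma sat_fm_all [simp]: "sat I e (fm_all n \<phi>) \<longleftrightarrow> (\<forall>t. sat I (e(n := t)) \<phi>)"
  by (simp add: fm_all_def)

lemma sat_fm_imp [simp]: "sat I e (fm_imp \<phi> \<psi>) \<longleftrightarrow> (sat I e \<phi> \<longrightarrow> sat I e \<psi>)"
  by (simp add: fm_imp_def)

context nonstandard_extension
begin

lemma transferD: "sat (\<lambda>A. A) e \<phi> \<Longrightarrow> sat star (map_sum \<iota> \<rho> \<circ> e) \<phi>"
  by (simp add: transfer)

text \<open>Each law is the transfer of one atomic formula with standard parameters: the extended
  graph of addition or multiplication is again the graph of that operation on
  \<open>'k\<close>.\<close>

lemma real_embedding: "real_embedding \<rho>"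
proof
  fix a b :: real
  let ?e = "\<lambda>c n. if n = 0 then Inr a else if n = (1::nat) then Inr b else Inr c"
  show "\<rho> (a + b) = \<rho> a + \<rho> b"
    using transferD[of "?e (a + b)" "Rel {v. \<exists>a b. v = [Inr a, Inr b, Inr (a + b)]} [0, 1, 2]"]
    by (simp add: star_add)
  show "\<rho> (a * b) = \<rho> a * \<rho> b"
    using transferD[of "?e (a * b)" "Rel {v. \<exists>a b. v = [Inr a, Inr b, Inr (a * b)]} [0, 1, 2]"]
    by (simp add: star_mult)
  show "\<rho> a \<le> \<rho> b \<longleftrightarrow> a \<le> b"
    \<comment> \<open>The order has to be reflected as well as preserved, so \<open>transfer\<close>
      is used as an equivalence.\<close>
    using transfer[of "?e 0" "Rel {[Inr a, Inr b] | a b. a \<le> b} [0, 1]"]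
    by (simp add: star_le)
qed

text \<open>The language has no function symbols, so the distance enters as its graph
  \<open>?R\<close>. Transfer first shows that the extended graph is functional with values in
  \<open>'k\<close>, then carries over the metric laws as statements about
  \<open>?R\<close>.\<close>

lemma hyperreal_pseudometric_star:
  assumes "Metric_space X d"
  shows "hyperreal_pseudometric \<rho> (star_set star X) (star_dist star X d)"
proof -
  interpret Metric_space X d by fact
  \<comment> \<open>This supplies \<open>\<rho> 0 = 0\<close>, the value of the parameter after
    transfer.\<close>
  interpret real_embedding \<rho> by (rule real_embedding)
  let ?S = "{[Inl x] | x. x \<in> X} :: ('a + real) list set"
  let ?R = "{[Inl a, Inl b, Inr (d a b)] | a b. a \<in> X \<and> b \<in> X} :: ('a + real) list set"
  let ?Real = "range (\<lambda>r. [Inr r]) :: ('a + real) list set"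
  let ?Add = "{v. \<exists>a b. v = [Inr a, Inr b, Inr (a + b)]} :: ('a + real) list set"
  let ?Le = "{[Inr a, Inr b] | a b. a \<le> b} :: ('a + real) list set"
  let ?Y = "star_set star X" and ?D = "star_dist star X d"
  \<comment> \<open>In the formulas below, variable \<open>0\<close> is a parameter with value the real number \<open>0\<close>.\<close>
  have ex: "\<exists>t. [x, y, t] \<in> star ?R" if "[x] \<in> star ?S" "[y] \<in> star ?S" for x y
  proof -
    have "sat (\<lambda>A. A) (\<lambda>_. Inr 0)
      (fm_all 1 (fm_all 2 (fm_imp (Rel ?S [1]) (fm_imp (Rel ?S [2]) (Ex 3 (Rel ?R [1, 2, 3]))))))"
      by auto
    from transferD[OF this] that show ?thesis
      by simp
  qed
  \<comment> \<open>A value in the extended graph could a priori be any atom in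
    \<open>'y + 'k\<close>; this excludes the left summand.\<close>
  have real: "[t] \<in> star ?Real" if "[x, y, t] \<in> star ?R" for x y t
  proof -
    have "sat (\<lambda>A. A) (\<lambda>_. Inr 0)
      (fm_all 1 (fm_all 2 (fm_all 3 (fm_imp (Rel ?R [1, 2, 3]) (Rel ?Real [3])))))"
      by auto
    from transferD[OF this] that show ?thesis
      by simp
  qed
  have unique: "t = u" if "[x, y, t] \<in> star ?R" "[x, y, u] \<in> star ?R" for x y t u
  proof -
    have "sat (\<lambda>A. A) (\<lambda>_. Inr 0)
      (fm_all 1 (fm_all 2 (fm_all 3 (fm_all 4 (fm_imp (Rel ?R [1, 2, 3]) (fm_imp (Rel ?R [1, 2, 4]) (Eq 3 4)))))))"
      by auto
    from transferD[OF this] that show ?thesis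
      by simp
  qed
  have refl: "t = Inr 0" if "[x, x, t] \<in> star ?R" for x t
  proof -
    have "sat (\<lambda>A. A) (\<lambda>_. Inr 0)
      (fm_all 1 (fm_all 2 (fm_imp (Rel ?R [1, 1, 2]) (Eq 2 0))))"
      by auto
    from transferD[OF this] that show ?thesis
      by simp
  qed
  have sym: "[y, x, t] \<in> star ?R" if "[x, y, t] \<in> star ?R" for x y t
  proof -
    have "sat (\<lambda>A. A) (\<lambda>_. Inr 0)
      (fm_all 1 (fm_all 2 (fm_all 3 (fm_imp (Rel ?R [1, 2, 3]) (Rel ?R [2, 1, 3])))))"
      by (auto simp: commute)
    from transferD[OF this] that show ?thesis
      by simp
  qed
  have nonneg: "[Inr 0, t] \<in> star ?Le" if "[x, y, t] \<in> star ?R" for x y t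
  proof -
    have "sat (\<lambda>A. A) (\<lambda>_. Inr 0)
      (fm_all 1 (fm_all 2 (fm_all 3 (fm_imp (Rel ?R [1, 2, 3]) (Rel ?Le [0, 3])))))"
      by auto
    from transferD[OF this] that show ?thesis
      by simp
  qed
  \<comment> \<open>Addition is a relation too: variables 4, 5 and 6 are the three distances, and
    variable 7 names the sum of the first two.\<close>
  have triangle: "[v, w] \<in> star ?Le"
    if "[x, y, t] \<in> star ?R" "[y, z, u] \<in> star ?R" "[x, z, v] \<in> star ?R" "[t, u, w] \<in> star ?Add"
    for x y z t u v w
  proof -
    have "sat (\<lambda>A. A) (\<lambda>_. Inr 0)
      (fm_all 1 (fm_all 2 (fm_all 3 (fm_all 4 (fm_all 5 (fm_all 6 (fm_all 7 (fm_imp (Rel ?R [1, 2, 4])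
      (fm_imp (Rel ?R [2, 3, 5]) (fm_imp (Rel ?R [1, 3, 6]) (fm_imp (Rel ?Add [4, 5, 7]) (Rel ?Le [6, 7]))))))))))))"
      by (auto simp: Metric_space.triangle[OF assms])
    from transferD[OF this] that show ?thesis
      by simp
  qed
  have D: "[Inl x, Inl y, Inr (?D x y)] \<in> star ?R" if xy: "x \<in> ?Y" "y \<in> ?Y" for x y
  proof -
    obtain t where t: "[Inl x, Inl y, t] \<in> star ?R"
      using ex xy by (auto simp: star_set_def)
    then have "[t] \<in> star ?Real"
      by (rule real)
    then obtain s where s: "[Inl x, Inl y, Inr s] \<in> star ?R"
      using t by (auto simp: star_reals)
    show ?thesis
      unfolding star_dist_def
    proof (rule theI[where P = "\<lambda>t. [Inl x, Inl y, Inr t] \<in> star ?R"])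
      fix t
      assume "[Inl x, Inl y, Inr t] \<in> star ?R"
      from unique[OF this s] show "t = s"
        by simp
    qed (rule s)
  qed
  show ?thesis
  proof
    fix x y
    assume xy: "x \<in> ?Y" "y \<in> ?Y"
    show "?D x x = 0"
      using refl[OF D[OF xy(1) xy(1)]] by simp
    show "0 \<le> ?D x y"
      using nonneg[OF D[OF xy]] by (simp add: star_le)
    show "?D x y = ?D y x"
      using unique[OF D[OF xy] sym[OF D[OF xy(2) xy(1)]]] by simp
    fix z
    assume z: "z \<in> ?Y"
    have "[Inr (?D x y), Inr (?D y z), Inr (?D x y + ?D y z)] \<in> star ?Add"
      by (simp add: star_add)
    from triangle[OF D[OF xy] D[OF xy(2) z] D[OF xy(1) z] this]
    show "?D x z \<le> ?D x y + ?D y z"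
      by (simp add: star_le)
  qed
qed

end

theorem theorem3:
  fixes X :: "'a set" and d :: "'a \<Rightarrow> 'a \<Rightarrow> real"
    and \<iota> :: "'a \<Rightarrow> 'y" and \<rho> :: "real \<Rightarrow> 'k::linordered_field"
    and star :: "('a + real) list set \<Rightarrow> ('y + 'k) list set"
    and \<alpha> \<beta> :: 'k
  defines "Y \<equiv> star_set star X" and "D \<equiv> star_dist star X d"
  assumes "nonstandard_extension \<iota> \<rho> star"
    and "Metric_space X d"
    and "0 < \<beta>" and "\<beta> < \<alpha>"
  shows "contraction \<rho> (\<beta> / \<alpha>) (scaling \<rho> Y D \<alpha>) (scaling \<rho> Y D \<beta>) (scale_map Y D \<beta> \<alpha>)"
  unfolding Y_def D_def
  using nonstandard_extension.hyperreal_pseudometric_star[OF assms(3,4)] assms(5,6)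
  by (rule hyperreal_pseudometric.contraction_scale_map)

end
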